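(* Every complete graph $K_n$ ($n\ge 1$) is good. That is, for every doubly nonnegative function $g$ on $[0,1]^2$, $$t(K_n,g)\;\ge\;\Big(\int_{[0,1]^2} g\,d\mu^2\Big)^{n(n-1)/2}.$$
   Context: $\mu$ is Lebesgue measure on $[0,1]$. $\mathcal{H}$ is the space of bounded measurable real functions on $[0,1]^2$. A bounded measurable nonnegative symmetric function $g$ on $[0,1]^2$ is called doubly nonnegative if there is $h\in\mathcal{H}$ (possibly taking negative values) with $g(x,y)=\int_{[0,1]}h(x,z)h(y,z)\,d\mu(z)$ for (almost) all $x,y$. For a finite simple graph $G$ with vertices $v_1,\dots,v_n$ and edge set $E(G)$, $t(G,g)=\int_{[0,1]^n}\prod_{\{v_i,v_j\}\in E(G)}g(x_i,x_j)\,d\mu^n$. A finite simple graph $G$ is called good if $t(G,g)\ge\left(\int_{[0,1]^2}g\,d\mu^2\right)^{|E(G)|}$ for every doubly nonnegative function $g$. *)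

theory Defs
  imports "HOL-Probability.Probability" "HOL-Library.Ramsey"
begin

abbreviation unit_leb :: "real measure"  ("\<mu>") where
  "\<mu> \<equiv> lebesgue_on {0..1}"

text \<open>
  Measurability on the square and on the cube means Lebesgue measurability. The library's
  product measures are not completed, so the completion is taken explicitly.
\<close>

abbreviation unit_square_leb :: "(real \<times> real) measure"  ("\<mu>\<^sub>2") where
  "\<mu>\<^sub>2 \<equiv> completion (\<mu> \<Otimes>\<^sub>M \<mu>)"

abbreviation unit_cube_leb :: "'a set \<Rightarrow> ('a \<Rightarrow> real) measure" where
  "unit_cube_leb V \<equiv> completion (\<Pi>\<^sub>M v\<in>V. \<mu>)"

text \<open>
  Functions on the square are curried and total on the reals; only their values
  on the square are constrained or used.
\<close>

definition bounded_measurable :: "(real \<Rightarrow> real \<Rightarrow> real) set" where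
  "bounded_measurable = {f. (\<lambda>(x, y). f x y) \<in> borel_measurable \<mu>\<^sub>2 \<and>
     (\<exists>C. \<forall>x\<in>{0..1}. \<forall>y\<in>{0..1}. \<bar>f x y\<bar> \<le> C)}"

definition doubly_nonnegative :: "(real \<Rightarrow> real \<Rightarrow> real) \<Rightarrow> bool" where
  "doubly_nonnegative g \<longleftrightarrow>
     g \<in> bounded_measurable \<and>
     (\<forall>x\<in>{0..1}. \<forall>y\<in>{0..1}. 0 \<le> g x y) \<and>
     (\<forall>x\<in>{0..1}. \<forall>y\<in>{0..1}. g x y = g y x) \<and>
     (\<exists>h\<in>bounded_measurable. AE (x, y) in \<mu>\<^sub>2. g x y = (\<integral>z. h x z * h y z \<partial>\<mu>))"

text \<open>
  A graph is given by its vertex set and its set of edges, which are two-element vertex sets.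
\<close>

definition finite_simple_graph :: "'a set \<Rightarrow> 'a set set \<Rightarrow> bool" where
  "finite_simple_graph V E \<longleftrightarrow> finite V \<and> E \<subseteq> nsets V 2"

text \<open>
  The linear order on the vertices serves only to name the two endpoints of an edge;
  for symmetric \<open>g\<close> the factor does not depend on which endpoint comes first.
\<close>

definition hom_density :: "'a::linorder set \<Rightarrow> 'a set set \<Rightarrow> (real \<Rightarrow> real \<Rightarrow> real) \<Rightarrow> real" where
  "hom_density V E g = (\<integral>x. (\<Prod>e\<in>E. g (x (Min e)) (x (Max e))) \<partial>unit_cube_leb V)"

definition good_graph :: "'a::linorder set \<Rightarrow> 'a set set \<Rightarrow> bool" where
  "good_graph V E \<longleftrightarrow> finite_simple_graph V E \<and>
     (\<forall>g. doubly_nonnegative g \<longrightarrow>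
        hom_density V E g \<ge> (\<integral>(x, y). g x y \<partial>\<mu>\<^sub>2) ^ card E)"

definition complete_verts :: "nat \<Rightarrow> nat set" where
  "complete_verts n = {1..n}"

definition complete_edges :: "nat \<Rightarrow> nat set set" where
  "complete_edges n = nsets (complete_verts n) 2"

end

theory Submission
  imports Defs
begin

text \<open>
  The clique densities are carried through an induction on the number of vertices in which the
  kernel stays the same and the measure varies. For a weight \<open>w \<ge> 0\<close> let \<open>W\<close> be its total mass,
  \<open>p = \<integral>\<integral> k(x,y) w(x) w(y)\<close>, and let \<open>F\<^sub>N(w)\<close> be the density of the complete graph on \<open>N\<close>
  vertices with respect to the measure \<open>w d\<mu>\<close>. The claim (\<open>clique_density_power_bound\<close>) is
  \<open>F\<^sub>N(w) W^(N(N-2)) \<ge> p^(N choose 2)\<close> for \<open>N \<ge> 2\<close>: it is the normalised statement for the probability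
  measure \<open>w d\<mu> / W\<close>, with denominators cleared. The weight \<open>w = 1\<close> gives the theorem
  for \<open>N \<ge> 2\<close>, and for a single vertex both sides are \<open>1\<close>.

  Fixing one vertex \<open>x\<close> of a clique leaves a clique on the other vertices with the weight
  \<open>w k(x,-)\<close>, so \<open>F\<^bsub>N+1\<^esub>(w) = \<integral> w(x) F\<^sub>N(w k(x,-))\<close> (\<open>clique_density_insert\<close>). The induction
  hypothesis bounds the integrand from below by a power of the triangle-type integral
  \<open>T(x) = \<integral>\<integral> k(x,y) k(x,z) k(y,z) w(y) w(z)\<close> divided by a power of the degree
  \<open>d(x) = \<integral> k(x,y) w(y)\<close>. Positive semidefiniteness enters through the Cauchy-Schwarz inequality
  for the form of the kernel (\<open>form_Cauchy_Schwarz\<close>), which gives \<open>T(x) p \<ge> e(x)\<^sup>2\<close> with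
  \<open>e(x) = \<integral> k(x,y) w(y) d(y)\<close>. What remains to be bounded is the integral of
  \<open>e^(N(N-1)) / d^(N(N-2))\<close>, a convex function of \<open>(d, e)\<close>. Instead of Hoelder or Jensen, the proof
  uses the tangent plane of this function at the point \<open>d = p/W\<close>, \<open>e = (p/W)\<^sup>2\<close>
  (\<open>jensen_tangent_bound\<close>), integrates it, and uses that the average of \<open>e\<close>, which by symmetry of
  the kernel is the average of \<open>d\<^sup>2\<close>, is at least the square of the average of \<open>d\<close>
  (\<open>degree_variance_bound\<close>).

  The induction needs kernels that are measurable for the product \<sigma>-algebra itself, so that
  Fubini and sections are available everywhere. A doubly nonnegative function is almost everywhere
  equal to such a kernel (\<open>doubly_nonnegative_kernel\<close>): replace \<open>h\<close> by a representative \<open>H\<close> that is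
  measurable for the product, and \<open>g\<close> by the positive part of \<open>\<integral> H(x,z) H(y,z) dz\<close>. Changing \<open>g\<close> on a
  null set of the square changes the edge product only on a null set of the cube.
\<close>

section \<open>Bounded measurable functions\<close>

text \<open>
  On a probability space these functions are integrable, and they are closed under products,
  sections and partial integration; below, integrability always comes from membership here.
\<close>
definition bdd_meas :: "'a measure \<Rightarrow> ('a \<Rightarrow> real) set" where
  "bdd_meas M = {f \<in> borel_measurable M. \<exists>B. \<forall>x\<in>space M. \<bar>f x\<bar> \<le> B}"

lemma bdd_measI: "f \<in> borel_measurable M \<Longrightarrow> (\<And>x. x \<in> space M \<Longrightarrow> \<bar>f x\<bar> \<le> B) \<Longrightarrow> f \<in> bdd_meas M"
  by (auto simp: bdd_meas_def)

lemma bdd_measE: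
  assumes "f \<in> bdd_meas M"
  obtains B where "B \<ge> 0" "\<And>x. x \<in> space M \<Longrightarrow> \<bar>f x\<bar> \<le> B"
proof -
  obtain B where "\<forall>x\<in>space M. \<bar>f x\<bar> \<le> B" using assms by (auto simp: bdd_meas_def)
  then show ?thesis by (intro that[of "max 0 B"]) (auto simp: le_max_iff_disj)
qed

lemma bdd_meas_measurable [measurable_dest]: "f \<in> bdd_meas M \<Longrightarrow> f \<in> borel_measurable M"
  by (simp add: bdd_meas_def)

lemma bdd_meas_const: "(\<lambda>_. c) \<in> bdd_meas M"
  by (rule bdd_measI[where B="\<bar>c\<bar>"]) auto

lemma bdd_meas_add:
  assumes "f \<in> bdd_meas M" "g \<in> bdd_meas M"
  shows "(\<lambda>x. f x + g x) \<in> bdd_meas M"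
proof -
  obtain B where B: "\<And>x. x \<in> space M \<Longrightarrow> \<bar>f x\<bar> \<le> B" using assms(1) by (metis bdd_measE)
  obtain C where C: "\<And>x. x \<in> space M \<Longrightarrow> \<bar>g x\<bar> \<le> C" using assms(2) by (metis bdd_measE)
  show ?thesis
    using assms B C by (intro bdd_measI[where B="B + C"]) (auto dest: bdd_meas_measurable intro: order_trans[OF abs_triangle_ineq] add_mono)
qed

lemma bdd_meas_mult:
  assumes "f \<in> bdd_meas M" "g \<in> bdd_meas M"
  shows "(\<lambda>x. f x * g x) \<in> bdd_meas M"
proof -
  obtain B where B: "\<And>x. x \<in> space M \<Longrightarrow> \<bar>f x\<bar> \<le> B" "B \<ge> 0" using assms(1) by (metis bdd_measE)
  obtain C where C: "\<And>x. x \<in> space M \<Longrightarrow> \<bar>g x\<bar> \<le> C" using assms(2) by (metis bdd_measE)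
  show ?thesis
    using assms B C
    by (intro bdd_measI[where B="B * C"]) (auto simp: abs_mult dest: bdd_meas_measurable intro: mult_mono)
qed

lemma bdd_meas_prod:
  assumes "\<And>i. i \<in> I \<Longrightarrow> f i \<in> bdd_meas M"
  shows "(\<lambda>x. \<Prod>i\<in>I. f i x) \<in> bdd_meas M"
  using assms by (induction I rule: infinite_finite_induct) (auto intro: bdd_meas_const bdd_meas_mult)

lemma bdd_meas_compose:
  assumes "f \<in> bdd_meas N" "\<phi> \<in> measurable M N"
  shows "(\<lambda>x. f (\<phi> x)) \<in> bdd_meas M"
proof -
  obtain B where "\<And>x. x \<in> space N \<Longrightarrow> \<bar>f x\<bar> \<le> B" using assms(1) by (metis bdd_measE)
  then show ?thesis
    using assms measurable_space[OF assms(2)]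
    by (intro bdd_measI[where B=B] measurable_compose[OF assms(2)]) (auto dest: bdd_meas_measurable)
qed

lemma (in finite_measure) bdd_meas_integrable:
  assumes "f \<in> bdd_meas M"
  shows "integrable M f"
proof -
  obtain B where "\<And>x. x \<in> space M \<Longrightarrow> \<bar>f x\<bar> \<le> B" using assms by (metis bdd_measE)
  then show ?thesis
    using assms by (intro integrable_const_bound[where B=B]) (auto dest: bdd_meas_measurable)
qed

lemma bdd_meas_pair_section:
  assumes "case_prod f \<in> bdd_meas (M \<Otimes>\<^sub>M N)" "x \<in> space M"
  shows "f x \<in> bdd_meas N"
  using bdd_meas_compose[OF assms(1) measurable_Pair1'[OF assms(2)]] by simp

lemma bdd_meas_integral:
  assumes "prob_space N" and f: "case_prod f \<in> bdd_meas (M \<Otimes>\<^sub>M N)"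
  shows "(\<lambda>x. \<integral>y. f x y \<partial>N) \<in> bdd_meas M"
proof -
  interpret N: prob_space N by fact
  obtain B where B: "B \<ge> 0" "\<And>z. z \<in> space (M \<Otimes>\<^sub>M N) \<Longrightarrow> \<bar>case_prod f z\<bar> \<le> B"
    using f by (metis bdd_measE)
  note [measurable] = bdd_meas_measurable[OF f]
  show ?thesis
  proof (rule bdd_measI[where B=B])
    fix x assume x: "x \<in> space M"
    have "\<bar>\<integral>y. f x y \<partial>N\<bar> \<le> (\<integral>y. B \<partial>N)"
      using B x bdd_meas_pair_section[OF f x, THEN N.bdd_meas_integrable]
      by (intro order_trans[OF integral_abs_bound] integral_mono) (auto simp: space_pair_measure)
    then show "\<bar>\<integral>y. f x y \<partial>N\<bar> \<le> B" by (simp add: N.prob_space)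
  qed measurable
qed

lemma bdd_meas_Fubini:
  assumes "prob_space M" "prob_space N" and f: "case_prod f \<in> bdd_meas (M \<Otimes>\<^sub>M N)"
  shows "(\<integral>x. \<integral>y. f x y \<partial>N \<partial>M) = (\<integral>y. \<integral>x. f x y \<partial>M \<partial>N)"
proof -
  interpret M: prob_space M by fact
  interpret N: prob_space N by fact
  interpret pair_prob_space M N ..
  show ?thesis
    by (rule Fubini_integral[symmetric]) (rule P.bdd_meas_integrable[OF f])
qed

section \<open>Edges and two elementary inequalities\<close>

lemma Min_Max_edge:
  fixes e :: "'v::linorder set"
  assumes "e \<in> nsets V 2"
  shows "Min e \<in> V" "Max e \<in> V"
proof -
  have "finite e" "e \<noteq> {}" "e \<subseteq> V" using assms by (auto simp: nsets_def)
  then show "Min e \<in> V" "Max e \<in> V" using Min_in Max_in by blast+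
qed

lemma nsets_insert_2:
  assumes "i \<notin> V"
  shows "nsets (insert i V) 2 = nsets V 2 \<union> (\<lambda>v. {i, v}) ` V"
  using assms by (auto simp: nsets_2_eq)

text \<open>
  The minimum of the quadratic over \<open>t\<close> is attained at \<open>t = - B / C\<close>. If \<open>C = 0\<close>, the quadratic is
  linear, and a nonzero slope would make it negative somewhere.
\<close>
lemma discriminant_bound:
  fixes A B C :: real
  assumes C: "0 \<le> C" and quad: "\<And>t. 0 \<le> A + 2 * t * B + t\<^sup>2 * C"
  shows "B\<^sup>2 \<le> A * C"
proof (cases "C = 0")
  case True
  have "B = 0"
  proof (rule ccontr)
    assume "B \<noteq> 0"
    then have "2 * (- (A + 1) / (2 * B)) * B = - (A + 1)"
      by simp
    then have "A + 2 * (- (A + 1) / (2 * B)) * B + (- (A + 1) / (2 * B))\<^sup>2 * C = -1"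
      unfolding True by linarith
    then show False using quad[of "- (A + 1) / (2 * B)"] by linarith
  qed
  then show ?thesis using True by simp
next
  case False
  then have "C > 0" using C by simp
  then have "A + 2 * (- B / C) * B + (- B / C)\<^sup>2 * C = A - B\<^sup>2 / C"
    by (simp add: power2_eq_square)
  then have "B\<^sup>2 / C \<le> A" using quad[of "- B / C"] by linarith
  then show ?thesis using \<open>C > 0\<close> by (simp add: pos_divide_le_eq)
qed

text \<open>
  The left-hand side is the tangent plane at \<open>(c, c\<^sup>2)\<close> of the convex function
  \<open>(d, e) \<mapsto> e^((n+2)(n+1)) / d^((n+2)n)\<close>, so the inequality is convexity in a form that also covers
  \<open>d = 0\<close>. With \<open>d = c s\<close> and \<open>e = c\<^sup>2 s u\<close> the function is \<open>c^((n+2)\<^sup>2)\<close> times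
  \<open>(s u^(n+1))^(n+2)\<close>, and two Bernoulli inequalities, one for each power, give its tangent plane
  at \<open>s = u = 1\<close>.
\<close>
lemma jensen_tangent_bound:
  fixes c d e Y :: real
  assumes c: "c > 0" and d: "d \<ge> 0" and e: "e \<ge> 0" and de: "d = 0 \<Longrightarrow> e = 0" and Y: "Y \<ge> 0"
    and bound: "e ^ ((n + 2) * (n + 1)) \<le> Y * d ^ ((n + 2) * n)"
  shows "c ^ ((n + 2) * (n + 2)) * ((real n + 2) * (real n + 1) * (e / c\<^sup>2) - (real n + 2) * real n * (d / c) - (real n + 1)) \<le> Y"
proof (cases "d = 0")
  case True
  then have "c ^ ((n + 2) * (n + 2)) * ((real n + 2) * (real n + 1) * (e / c\<^sup>2) - (real n + 2) * real n * (d / c) - (real n + 1)) \<le> 0"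
    using c de by (intro mult_nonneg_nonpos) auto
  with Y show ?thesis by linarith
next
  case False
  then have d: "d > 0" using d by simp
  define s u where "s = d / c" and "u = e / (c * d)"
  have su: "s > 0" "u \<ge> 0" using c d e by (auto simp: s_def u_def)
  have ds: "d = c * s" and es: "e = c\<^sup>2 * (s * u)"
    using c d by (auto simp: s_def u_def field_simps power2_eq_square)
  have "1 + real (n + 1) * (u - 1) \<le> u ^ (n + 1)"
    using Bernoulli_inequality[of "u - 1" "n + 1"] su by simp
  then have "s * (1 + real (n + 1) * (u - 1)) \<le> s * u ^ (n + 1)"
    using su by (intro mult_left_mono) auto
  then have "1 + real (n + 2) * (s * (1 + real (n + 1) * (u - 1)) - 1) \<le> 1 + real (n + 2) * (s * u ^ (n + 1) - 1)"
    by (intro add_left_mono mult_left_mono) auto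
  also have "\<dots> \<le> (s * u ^ (n + 1)) ^ (n + 2)"
    using Bernoulli_inequality[of "s * u ^ (n + 1) - 1" "n + 2"] su by simp
  finally have B: "1 + real (n + 2) * (s * (1 + real (n + 1) * (u - 1)) - 1) \<le> (s * u ^ (n + 1)) ^ (n + 2)" .
  have dn: "d ^ ((n + 2) * n) = (d ^ n) ^ (n + 2)"
    by (simp only: mult.commute[of "n + 2" n] power_mult)
  have "c ^ ((n + 2) * (n + 2)) * (s * u ^ (n + 1)) ^ (n + 2) * d ^ ((n + 2) * n)
      = (c ^ (n + 2) * (s * u ^ (n + 1)) * d ^ n) ^ (n + 2)"
    by (simp only: dn) (simp only: power_mult power_mult_distrib)
  also have "c ^ (n + 2) * (s * u ^ (n + 1)) * d ^ n = e ^ (n + 1)"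
    by (simp add: ds es power_mult_distrib power_add power2_eq_square)
  also have "(e ^ (n + 1)) ^ (n + 2) \<le> Y * d ^ ((n + 2) * n)"
    using bound by (simp only: power_mult[symmetric] mult.commute)
  finally have "c ^ ((n + 2) * (n + 2)) * (s * u ^ (n + 1)) ^ (n + 2) \<le> Y"
    using d by simp
  moreover have "c ^ ((n + 2) * (n + 2)) * ((real n + 2) * (real n + 1) * (e / c\<^sup>2) - (real n + 2) * real n * (d / c) - (real n + 1))
      \<le> c ^ ((n + 2) * (n + 2)) * (s * u ^ (n + 1)) ^ (n + 2)"
  proof (intro mult_left_mono)
    have "e / c\<^sup>2 = s * u" "d / c = s" using c by (auto simp: es ds)
    then show "(real n + 2) * (real n + 1) * (e / c\<^sup>2) - (real n + 2) * real n * (d / c) - (real n + 1) \<le> (s * u ^ (n + 1)) ^ (n + 2)"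
      using B by (simp add: algebra_simps)
  qed (use c in auto)
  ultimately show ?thesis by linarith
qed

section \<open>Clique densities of a positive semidefinite kernel\<close>

text \<open>
  Nonnegativity is required pointwise, because the functions \<open>y \<mapsto> w y * k x y\<close> serve as
  weights for every \<open>x\<close>.
\<close>
locale psd_kernel = prob_space M for M :: "'a measure" +
  fixes k :: "'a \<Rightarrow> 'a \<Rightarrow> real"
  assumes k_bdd_meas: "case_prod k \<in> bdd_meas (M \<Otimes>\<^sub>M M)"
    and k_nonneg: "x \<in> space M \<Longrightarrow> y \<in> space M \<Longrightarrow> 0 \<le> k x y"
    and k_sym: "x \<in> space M \<Longrightarrow> y \<in> space M \<Longrightarrow> k x y = k y x"
    and k_psd: "a \<in> bdd_meas M \<Longrightarrow> 0 \<le> (\<integral>x. a x * (\<integral>y. k x y * a y \<partial>M) \<partial>M)"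
begin

definition weighted_degree :: "('a \<Rightarrow> real) \<Rightarrow> 'a \<Rightarrow> real" where
  "weighted_degree w x = (\<integral>y. k x y * w y \<partial>M)"

definition form :: "('a \<Rightarrow> real) \<Rightarrow> ('a \<Rightarrow> real) \<Rightarrow> real" where
  "form a b = (\<integral>x. a x * weighted_degree b x \<partial>M)"

text \<open>
  The density of the complete graph on \<open>V\<close> for the measure with density \<open>w\<close> with respect to \<open>M\<close>.
  Keeping the weight as a factor, without normalising it, avoids changing the measure space in
  the induction.
\<close>
definition clique_density :: "'v::linorder set \<Rightarrow> ('a \<Rightarrow> real) \<Rightarrow> real" where
  "clique_density V w = (\<integral>x. (\<Prod>v\<in>V. w (x v)) * (\<Prod>e\<in>nsets V 2. k (x (Min e)) (x (Max e)))
     \<partial>Pi\<^sub>M V (\<lambda>_. M))"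

lemma section_bdd_meas: "x \<in> space M \<Longrightarrow> k x \<in> bdd_meas M"
  by (rule bdd_meas_pair_section[OF k_bdd_meas])

lemma kernel_compose_bdd_meas:
  assumes "f \<in> measurable N M" "g \<in> measurable N M"
  shows "(\<lambda>z. k (f z) (g z)) \<in> bdd_meas N"
  using bdd_meas_compose[OF k_bdd_meas measurable_Pair[OF assms]] by simp

lemma weighted_degree_bdd_meas:
  assumes "w \<in> bdd_meas M"
  shows "weighted_degree w \<in> bdd_meas M"
  unfolding weighted_degree_def
  by (intro bdd_meas_integral prob_space_axioms)
    (unfold case_prod_unfold, intro kernel_compose_bdd_meas bdd_meas_mult bdd_meas_compose[OF assms]
      measurable_fst measurable_snd)

lemma form_integrable: "a \<in> bdd_meas M \<Longrightarrow> b \<in> bdd_meas M \<Longrightarrow> integrable M (\<lambda>x. a x * weighted_degree b x)"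
  by (intro bdd_meas_integrable bdd_meas_mult weighted_degree_bdd_meas)

text \<open>
  Fubini and the symmetry of the kernel.
\<close>
lemma form_sym:
  assumes a: "a \<in> bdd_meas M" and b: "b \<in> bdd_meas M"
  shows "form a b = form b a"
proof -
  have "form a b = (\<integral>x. \<integral>y. a x * (k x y * b y) \<partial>M \<partial>M)"
    by (simp add: form_def weighted_degree_def)
  also have "\<dots> = (\<integral>y. \<integral>x. a x * (k x y * b y) \<partial>M \<partial>M)"
    by (intro bdd_meas_Fubini prob_space_axioms)
      (unfold case_prod_unfold, intro kernel_compose_bdd_meas bdd_meas_mult
         bdd_meas_compose[OF a] bdd_meas_compose[OF b] measurable_fst measurable_snd)
  also have "\<dots> = (\<integral>y. \<integral>x. b y * (k y x * a x) \<partial>M \<partial>M)"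
    by (intro Bochner_Integration.integral_cong refl) (auto simp: k_sym mult_ac)
  finally show ?thesis by (simp add: form_def weighted_degree_def)
qed

lemma weighted_degree_add_scale:
  assumes a: "a \<in> bdd_meas M" and b: "b \<in> bdd_meas M" and x: "x \<in> space M"
  shows "weighted_degree (\<lambda>y. a y + t * b y) x = weighted_degree a x + t * weighted_degree b x"
proof -
  have "integrable M (\<lambda>y. k x y * a y)" "integrable M (\<lambda>y. k x y * b y)"
    using assms by (auto intro!: bdd_meas_integrable bdd_meas_mult section_bdd_meas)
  moreover have "k x y * (a y + t * b y) = k x y * a y + t * (k x y * b y)" for y
    by (simp add: distrib_left)
  ultimately show ?thesis by (simp add: weighted_degree_def)
qed

lemma form_nonneg: "a \<in> bdd_meas M \<Longrightarrow> 0 \<le> form a a"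
  using k_psd[of a] by (simp add: form_def weighted_degree_def)

text \<open>
  The usual argument for a semidefinite form: \<open>form (a + t b) (a + t b)\<close> is a nonnegative quadratic
  polynomial in \<open>t\<close>.
\<close>
lemma form_Cauchy_Schwarz:
  assumes a: "a \<in> bdd_meas M" and b: "b \<in> bdd_meas M"
  shows "(form a b)\<^sup>2 \<le> form a a * form b b"
proof -
  have quad: "0 \<le> form a a + 2 * t * form a b + t\<^sup>2 * form b b" for t
  proof -
    have "0 \<le> form (\<lambda>y. a y + t * b y) (\<lambda>y. a y + t * b y)"
      by (intro form_nonneg bdd_meas_add bdd_meas_mult bdd_meas_const a b)
    also have "\<dots> = (\<integral>x. a x * weighted_degree a x + t * (a x * weighted_degree b x) + t * (b x * weighted_degree a x)
        + t\<^sup>2 * (b x * weighted_degree b x) \<partial>M)"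
      unfolding form_def using a b
      by (intro Bochner_Integration.integral_cong refl)
        (simp add: weighted_degree_add_scale algebra_simps power2_eq_square)
    also have "\<dots> = form a a + t * form a b + t * form b a + t\<^sup>2 * form b b"
      using a b by (simp add: form_integrable form_def)
    finally show ?thesis by (simp add: form_sym[OF b a])
  qed
  show ?thesis by (rule discriminant_bound[OF form_nonneg[OF b] quad])
qed

lemma clique_integrand_bdd_meas:
  assumes w: "w \<in> bdd_meas M" and V: "finite V"
  shows "(\<lambda>x. (\<Prod>v\<in>V. w (x v)) * (\<Prod>e\<in>nsets V 2. k (x (Min e)) (x (Max e))))
    \<in> bdd_meas (Pi\<^sub>M V (\<lambda>_. M))"
proof -
  have "Min e \<in> V" "Max e \<in> V" if "e \<in> nsets V 2" for e
    using Min_Max_edge[OF that] by auto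
  then show ?thesis
    by (intro bdd_meas_mult bdd_meas_prod bdd_meas_compose[OF w] kernel_compose_bdd_meas
        measurable_component_singleton) auto
qed

text \<open>
  The edges at the new vertex \<open>i\<close>, whose coordinate is \<open>y\<close>, contribute the factors \<open>k y (x v)\<close>, which
  are absorbed into the weights of the other vertices. By symmetry of the kernel the position of
  \<open>i\<close> in the vertex order does not matter.
\<close>
lemma clique_integrand_insert:
  assumes V: "finite V" "i \<notin> V" and x: "x \<in> space (Pi\<^sub>M V (\<lambda>_. M))" and y: "y \<in> space M"
  shows "(\<Prod>v\<in>insert i V. w ((x(i := y)) v)) *
      (\<Prod>e\<in>nsets (insert i V) 2. k ((x(i := y)) (Min e)) ((x(i := y)) (Max e)))
    = w y * ((\<Prod>v\<in>V. w (x v) * k y (x v)) * (\<Prod>e\<in>nsets V 2. k (x (Min e)) (x (Max e))))"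
proof -
  let ?x = "x(i := y)"
  have xV: "x v \<in> space M" if "v \<in> V" for v using x that by (auto simp: space_PiM)
  have new: "k (?x (Min {i, v})) (?x (Max {i, v})) = k y (x v)" if "v \<in> V" for v
    using V that k_sym[OF y xV[OF that]]
    by (cases "i < v") (auto simp: min_def max_def)
  have old: "k (?x (Min e)) (?x (Max e)) = k (x (Min e)) (x (Max e))" if "e \<in> nsets V 2" for e
  proof -
    have "Min e \<in> V" "Max e \<in> V" using Min_Max_edge[OF that] by auto
    then show ?thesis using V by auto
  qed
  have inj: "inj_on (\<lambda>v. {i, v}) V" by (auto simp: inj_on_def doubleton_eq_iff)
  have "(\<Prod>e\<in>nsets (insert i V) 2. k (?x (Min e)) (?x (Max e)))
     = (\<Prod>e\<in>nsets V 2. k (?x (Min e)) (?x (Max e))) *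
       (\<Prod>e\<in>(\<lambda>v. {i, v}) ` V. k (?x (Min e)) (?x (Max e)))"
    unfolding nsets_insert_2[OF V(2)] using V
    by (intro prod.union_disjoint finite_imp_finite_nsets finite_imageI) (auto simp: nsets_def)
  also have "\<dots> = (\<Prod>e\<in>nsets V 2. k (x (Min e)) (x (Max e))) * (\<Prod>v\<in>V. k y (x v))"
    by (simp only: prod.reindex[OF inj] comp_def old new cong: prod.cong)
  finally have edges: "(\<Prod>e\<in>nsets (insert i V) 2. k (?x (Min e)) (?x (Max e))) = \<dots>" .
  have "(\<Prod>v\<in>insert i V. w (?x v)) = w y * (\<Prod>v\<in>V. w (x v))"
    using V by (auto intro!: prod.cong)
  then show ?thesis by (simp only: edges prod.distrib mult_ac)
qed

lemma clique_density_nonneg: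
  assumes "finite V" and w: "\<And>x. x \<in> space M \<Longrightarrow> 0 \<le> w x"
  shows "0 \<le> clique_density V w"
  unfolding clique_density_def
proof (intro integral_nonneg_AE AE_I2 mult_nonneg_nonneg prod_nonneg ballI)
  fix x e assume x: "x \<in> space (Pi\<^sub>M V (\<lambda>_. M))" and e: "e \<in> nsets V 2"
  have "Min e \<in> V" "Max e \<in> V" using Min_Max_edge[OF e] by auto
  then show "0 \<le> k (x (Min e)) (x (Max e))" using x by (auto simp: space_PiM intro!: k_nonneg)
qed (auto simp: space_PiM intro!: w)

text \<open>
  The recursion behind the induction: integrate over the coordinate of the new vertex last. The
  kernel is unchanged and only the weight is multiplied by a section of the kernel.
\<close>
lemma clique_density_insert:
  assumes V: "finite V" "i \<notin> V" and w: "w \<in> bdd_meas M"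
  shows "clique_density (insert i V) w = (\<integral>y. w y * clique_density V (\<lambda>z. w z * k y z) \<partial>M)"
    and "(\<lambda>y. clique_density V (\<lambda>z. w z * k y z)) \<in> bdd_meas M"
proof -
  let ?P = "Pi\<^sub>M V (\<lambda>_. M)"
  interpret product_sigma_finite "\<lambda>_::'b. M" ..
  interpret P: prob_space ?P by (intro prob_space_PiM prob_space_axioms)
  interpret P': prob_space "Pi\<^sub>M (insert i V) (\<lambda>_. M)" by (intro prob_space_PiM prob_space_axioms)
  define f where "f y x = (\<Prod>v\<in>V. w (x v) * k y (x v)) * (\<Prod>e\<in>nsets V 2. k (x (Min e)) (x (Max e)))"
    for y and x :: "'b \<Rightarrow> 'a"
  have mem: "Min e \<in> V" "Max e \<in> V" if "e \<in> nsets V 2" for e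
    using Min_Max_edge[OF that] by auto
  have comp: "(\<lambda>z. snd z v) \<in> measurable (M \<Otimes>\<^sub>M ?P) M" if "v \<in> V" for v
    using that by measurable
  have f: "case_prod f \<in> bdd_meas (M \<Otimes>\<^sub>M ?P)"
    unfolding f_def case_prod_unfold
    by (intro bdd_meas_mult bdd_meas_prod bdd_meas_compose[OF w] kernel_compose_bdd_meas
        comp mem measurable_fst)
  have clique_f: "clique_density V (\<lambda>z. w z * k y z) = (\<integral>x. f y x \<partial>?P)" for y
    by (simp add: clique_density_def f_def)
  show "(\<lambda>y. clique_density V (\<lambda>z. w z * k y z)) \<in> bdd_meas M"
    unfolding clique_f by (intro bdd_meas_integral P.prob_space_axioms f)
  have wf: "(\<lambda>(x, y). w y * f y x) \<in> bdd_meas (?P \<Otimes>\<^sub>M M)"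
    using bdd_meas_compose[OF f measurable_pair_swap'] bdd_meas_compose[OF w measurable_snd, of ?P]
    by (auto simp: case_prod_unfold intro: bdd_meas_mult)
  have "clique_density (insert i V) w = (\<integral>x. \<integral>y. (\<Prod>v\<in>insert i V. w ((x(i := y)) v)) *
      (\<Prod>e\<in>nsets (insert i V) 2. k ((x(i := y)) (Min e)) ((x(i := y)) (Max e))) \<partial>M \<partial>?P)"
    unfolding clique_density_def using V w
    by (intro product_integral_insert P'.bdd_meas_integrable clique_integrand_bdd_meas) auto
  also have "\<dots> = (\<integral>x. \<integral>y. w y * f y x \<partial>M \<partial>?P)"
    by (intro Bochner_Integration.integral_cong refl)
      (simp only: clique_integrand_insert[OF V] f_def)
  also have "\<dots> = (\<integral>y. \<integral>x. w y * f y x \<partial>?P \<partial>M)"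
    by (intro bdd_meas_Fubini P.prob_space_axioms prob_space_axioms wf)
  finally show "clique_density (insert i V) w = (\<integral>y. w y * clique_density V (\<lambda>z. w z * k y z) \<partial>M)"
    by (simp add: clique_f)
qed

lemma clique_density_empty: "clique_density {} w = 1"
proof -
  interpret P: prob_space "Pi\<^sub>M {} (\<lambda>_. M)" by (intro prob_space_PiM prob_space_axioms)
  have "nsets ({}::'b set) 2 = {}" by (auto simp: nsets_def)
  then show ?thesis by (simp add: clique_density_def P.prob_space)
qed

lemma clique_density_two:
  assumes w: "w \<in> bdd_meas M" and V: "card V = 2"
  shows "clique_density V w = form w w"
proof -
  obtain i j where V: "V = {i, j}" "i \<noteq> j" using V by (auto simp: card_2_iff)
  have one: "clique_density {j} u = (\<integral>x. u x \<partial>M)" if "u \<in> bdd_meas M" for u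
    using clique_density_insert(1)[of "{}" j u] that by (simp add: clique_density_empty)
  have "clique_density V w = (\<integral>x. w x * clique_density {j} (\<lambda>y. w y * k x y) \<partial>M)"
    using clique_density_insert(1)[of "{j}" i w] w V by simp
  also have "\<dots> = (\<integral>x. w x * (\<integral>y. w y * k x y \<partial>M) \<partial>M)"
    using w by (intro Bochner_Integration.integral_cong refl arg_cong2[where f="(*)"] one)
      (auto intro: section_bdd_meas bdd_meas_mult)
  finally show ?thesis by (simp add: form_def weighted_degree_def mult.commute)
qed

lemma weighted_degree_nonneg:
  assumes "\<And>y. y \<in> space M \<Longrightarrow> 0 \<le> w y" "x \<in> space M"
  shows "0 \<le> weighted_degree w x"
  unfolding weighted_degree_def using assms by (intro integral_nonneg_AE AE_I2 mult_nonneg_nonneg k_nonneg)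

text \<open>
  The integrand of a vanishing degree is nonnegative, hence zero almost everywhere. This supplies
  the side condition at \<open>d = 0\<close> in the tangent bound.
\<close>
lemma weighted_degree_mult_eq_0:
  assumes w: "w \<in> bdd_meas M" "\<And>y. y \<in> space M \<Longrightarrow> 0 \<le> w y" and v: "v \<in> bdd_meas M"
    and x: "x \<in> space M" and "weighted_degree w x = 0"
  shows "weighted_degree (\<lambda>y. w y * v y) x = 0"
proof -
  have "integrable M (\<lambda>y. k x y * w y)"
    by (intro bdd_meas_integrable bdd_meas_mult section_bdd_meas w x)
  then have "AE y in M. k x y * w y = 0"
    using \<open>weighted_degree w x = 0\<close> w x
    by (subst (asm) weighted_degree_def, subst (asm) integral_nonneg_eq_0_iff_AE)
      (auto intro!: AE_I2 mult_nonneg_nonneg k_nonneg)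
  then have "AE y in M. k x y * (w y * v y) = 0" by eventually_elim auto
  then show ?thesis unfolding weighted_degree_def by (rule integral_eq_zero_AE)
qed

lemma integral_weight_pos:
  assumes w: "w \<in> bdd_meas M" "\<And>y. y \<in> space M \<Longrightarrow> 0 \<le> w y" and "form w w > 0"
  shows "(\<integral>x. w x \<partial>M) > 0"
proof (rule ccontr)
  assume "\<not> ?thesis"
  moreover have "0 \<le> (\<integral>x. w x \<partial>M)" using w by (intro integral_nonneg_AE AE_I2)
  ultimately have "(\<integral>x. w x \<partial>M) = 0" by simp
  then have "AE x in M. w x = 0"
    using w bdd_meas_integrable[OF w(1)] by (subst (asm) integral_nonneg_eq_0_iff_AE) auto
  then have "AE x in M. w x * weighted_degree w x = 0" by eventually_elim auto
  then have "form w w = 0" unfolding form_def by (rule integral_eq_zero_AE)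
  then show False using \<open>form w w > 0\<close> by simp
qed

text \<open>
  The right-hand side equals \<open>\<integral> w d\<^sup>2\<close> for the weighted degree \<open>d\<close>, by symmetry of the form, and the
  inequality says \<open>\<integral> w (d - c)\<^sup>2 \<ge> 0\<close>. It is applied with \<open>c\<close> the \<open>w\<close>-average of \<open>d\<close>.
\<close>
lemma degree_variance_bound:
  assumes w: "w \<in> bdd_meas M" "\<And>y. y \<in> space M \<Longrightarrow> 0 \<le> w y"
  shows "2 * c * form w w - c\<^sup>2 * (\<integral>x. w x \<partial>M) \<le> form w (\<lambda>x. w x * weighted_degree w x)"
proof -
  have wd: "(\<lambda>x. w x * weighted_degree w x) \<in> bdd_meas M" by (intro bdd_meas_mult weighted_degree_bdd_meas w)
  have "form w (\<lambda>x. w x * weighted_degree w x) = (\<integral>x. w x * weighted_degree w x * weighted_degree w x \<partial>M)"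
    unfolding form_sym[OF w(1) wd] by (simp add: form_def)
  moreover have "0 \<le> (\<integral>x. w x * (weighted_degree w x - c)\<^sup>2 \<partial>M)"
    using w by (intro integral_nonneg_AE AE_I2 mult_nonneg_nonneg) auto
  moreover have "(\<integral>x. w x * (weighted_degree w x - c)\<^sup>2 \<partial>M)
      = (\<integral>x. w x * weighted_degree w x * weighted_degree w x - 2 * c * (w x * weighted_degree w x) + c\<^sup>2 * w x \<partial>M)"
    by (intro Bochner_Integration.integral_cong refl) (simp add: power2_eq_square algebra_simps)
  moreover have "\<dots> = (\<integral>x. w x * weighted_degree w x * weighted_degree w x \<partial>M) - 2 * c * form w w + c\<^sup>2 * (\<integral>x. w x \<partial>M)"
    using bdd_meas_integrable[OF w(1)] bdd_meas_integrable[OF wd] form_integrable[OF wd w(1)]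
    by (simp add: form_def)
  ultimately show ?thesis by linarith
qed

text \<open>
  Both sides scale in the same way in \<open>w\<close>, so this is the bound for the probability measure
  proportional to \<open>w\<close>. It has to be proved for all weights at once: the step from \<open>n + 2\<close> to
  \<open>n + 3\<close> vertices applies the hypothesis to the weights \<open>w y * k x y\<close>. The induction starts at two
  vertices, where equality holds; for a single vertex the exponent of the total mass would be
  negative.
\<close>
lemma clique_density_power_bound:
  fixes V :: "'v::linorder set"
  assumes "w \<in> bdd_meas M" "\<And>y. y \<in> space M \<Longrightarrow> 0 \<le> w y" "card V = n + 2"
  shows "form w w ^ ((n + 2) choose 2) \<le> clique_density V w * (\<integral>x. w x \<partial>M) ^ ((n + 2) * n)"
  using assms
proof (induction n arbitrary: V w)
  case 0
  then show ?case by (simp add: clique_density_two numeral_2_eq_2)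
next
  case (Suc n)
  note w = Suc.prems(1,2)
  obtain i U where V: "V = insert i U" "i \<notin> U" "card U = n + 2" "finite U"
    using Suc.prems(3) by (metis add_Suc card_Suc_eq_finite)
  define p W m N where "p = form w w" and "W = (\<integral>x. w x \<partial>M)" and "m = (n + 2) choose 2"
    and "N = (n + 2) * (n + 2)"
  have m2: "(n + 2) * (n + 1) = 2 * m"
    by (simp add: m_def choose_two)
  have choose: "(Suc n + 2) choose 2 = m + (n + 2)"
    by (simp add: m_def numeral_2_eq_2)
  have N: "N = Suc ((Suc n + 2) * Suc n)" "N = m + (m + (n + 2))"
    using m2 by (auto simp: N_def algebra_simps)
  show ?case
  proof (cases "p = 0")
    case True
    have "0 \<le> clique_density V w" "0 \<le> W"
      using V w by (auto simp: W_def intro!: clique_density_nonneg integral_nonneg_AE AE_I2)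
    then have "0 \<le> clique_density V w * W ^ ((Suc n + 2) * Suc n)" by simp
    moreover have "p ^ (m + (n + 2)) = 0" using True by simp
    ultimately show ?thesis unfolding choose p_def[symmetric] W_def[symmetric] by linarith
  next
    case False
    then have p: "p > 0" using form_nonneg[OF w(1)] by (simp add: p_def)
    have W: "W > 0" using integral_weight_pos[OF w] p by (simp add: p_def W_def)
    \<comment> \<open>the mean weighted degree, at which the tangent plane is taken\<close>
    define c where "c = p / W"
    have c: "c > 0" using p W by (simp add: c_def)
    define d e \<Phi> where "d = weighted_degree w" and "e = weighted_degree (\<lambda>y. w y * weighted_degree w y)"
      and "\<Phi> = (\<lambda>x. clique_density U (\<lambda>y. w y * k x y))"
    have wd: "(\<lambda>x. w x * weighted_degree w x) \<in> bdd_meas M" by (intro bdd_meas_mult weighted_degree_bdd_meas w)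
    have pointwise: "c ^ N * ((real n + 2) * (real n + 1) * (e x / c\<^sup>2)
        - (real n + 2) * real n * (d x / c) - (real n + 1)) \<le> p ^ m * \<Phi> x"
      if x: "x \<in> space M" for x
    proof -
      let ?u = "\<lambda>y. w y * k x y"
      have u: "?u \<in> bdd_meas M" "\<And>y. y \<in> space M \<Longrightarrow> 0 \<le> ?u y"
        using w x by (auto intro!: bdd_meas_mult section_bdd_meas k_nonneg mult_nonneg_nonneg)
      have "form ?u ?u ^ m \<le> \<Phi> x * (\<integral>y. ?u y \<partial>M) ^ ((n + 2) * n)"
        unfolding m_def \<Phi>_def by (rule Suc.IH[OF u V(3)])
      also have "(\<integral>y. ?u y \<partial>M) = d x" by (simp add: d_def weighted_degree_def mult.commute)
      finally have IH: "form ?u ?u ^ m \<le> \<Phi> x * d x ^ ((n + 2) * n)" .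
      \<comment> \<open>\<open>form ?u ?u\<close> is the triangle-type integral at \<open>x\<close>; compare \<open>?u\<close> with \<open>w\<close>\<close>
      have "form ?u w = e x"
        by (simp add: form_def e_def weighted_degree_def[of "\<lambda>y. w y * weighted_degree w y"] mult_ac)
      then have "(e x)\<^sup>2 \<le> form ?u ?u * p"
        using form_Cauchy_Schwarz[OF u(1) w(1)] by (simp add: p_def)
      then have "((e x)\<^sup>2) ^ m \<le> (form ?u ?u * p) ^ m" by (intro power_mono) auto
      also have "\<dots> = p ^ m * form ?u ?u ^ m" by (simp add: power_mult_distrib)
      also have "\<dots> \<le> p ^ m * (\<Phi> x * d x ^ ((n + 2) * n))"
        using p by (intro mult_left_mono IH) auto
      finally have "e x ^ ((n + 2) * (n + 1)) \<le> p ^ m * \<Phi> x * d x ^ ((n + 2) * n)"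
        by (simp only: m2 power_mult mult.assoc)
      then show ?thesis
        unfolding N_def
      proof (intro jensen_tangent_bound c)
        show "0 \<le> d x" "0 \<le> e x"
          unfolding d_def e_def using w x by (auto intro!: weighted_degree_nonneg mult_nonneg_nonneg)
        show "e x = 0" if "d x = 0"
          using weighted_degree_mult_eq_0[OF w weighted_degree_bdd_meas[OF w(1)] x] that by (simp add: d_def e_def)
        show "0 \<le> p ^ m * \<Phi> x"
          unfolding \<Phi>_def using p V(4) by (intro mult_nonneg_nonneg clique_density_nonneg u) auto
      qed
    qed
    have int: "integrable M w" "integrable M (\<lambda>x. w x * d x)" "integrable M (\<lambda>x. w x * e x)"
      "integrable M (\<lambda>x. w x * \<Phi> x)"
      using w wd clique_density_insert(2)[OF V(4,2) w(1)] unfolding d_def e_def \<Phi>_def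
      by (auto intro!: bdd_meas_integrable bdd_meas_mult weighted_degree_bdd_meas)
    have "c\<^sup>2 * W \<le> form w (\<lambda>x. w x * weighted_degree w x)"
      using degree_variance_bound[OF w, of c] W
      by (simp add: c_def power2_eq_square flip: p_def W_def)
    then have we: "c\<^sup>2 * W \<le> (\<integral>x. w x * e x \<partial>M)" by (simp add: form_def e_def)
    have wd_int: "(\<integral>x. w x * d x \<partial>M) = c * W"
      using W by (simp add: c_def p_def form_def d_def)
    \<comment> \<open>the coefficients of the tangent plane satisfy \<open>(n+2)(n+1) - (n+2)n - (n+1) = 1\<close>\<close>
    have "c ^ N * W = c ^ N * ((real n + 2) * (real n + 1) * (c\<^sup>2 * W / c\<^sup>2)
        - (real n + 2) * real n * (c * W / c) - (real n + 1) * W)"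
      using c by (simp add: algebra_simps)
    also have "\<dots> \<le> c ^ N * ((real n + 2) * (real n + 1) * ((\<integral>x. w x * e x \<partial>M) / c\<^sup>2)
        - (real n + 2) * real n * ((\<integral>x. w x * d x \<partial>M) / c) - (real n + 1) * W)"
      unfolding wd_int using c we
      by (intro mult_left_mono diff_right_mono divide_right_mono) auto
    also have "\<dots> = (\<integral>x. c ^ N * ((real n + 2) * (real n + 1) * (w x * e x / c\<^sup>2)
        - (real n + 2) * real n * (w x * d x / c) - (real n + 1) * w x) \<partial>M)"
      using int by (simp add: W_def)
    also have "\<dots> = (\<integral>x. w x * (c ^ N * ((real n + 2) * (real n + 1) * (e x / c\<^sup>2)
        - (real n + 2) * real n * (d x / c) - (real n + 1))) \<partial>M)"
      by (intro Bochner_Integration.integral_cong refl) (simp add: algebra_simps)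
    also have "\<dots> \<le> (\<integral>x. w x * (p ^ m * \<Phi> x) \<partial>M)"
    proof (rule integral_mono_AE)
      show "integrable M (\<lambda>x. w x * (p ^ m * \<Phi> x))"
        using integrable_mult_right[OF int(4), of "p ^ m"] by (simp add: mult_ac)
      have "integrable M (\<lambda>x. c ^ N * ((real n + 2) * (real n + 1) * (w x * e x / c\<^sup>2)
        - (real n + 2) * real n * (w x * d x / c) - (real n + 1) * w x))"
        using int by simp
      then show "integrable M (\<lambda>x. w x * (c ^ N * ((real n + 2) * (real n + 1) * (e x / c\<^sup>2)
        - (real n + 2) * real n * (d x / c) - (real n + 1))))"
        by (rule back_subst[of "integrable M"]) (simp add: fun_eq_iff algebra_simps)
    qed (intro AE_I2 mult_left_mono pointwise w)
    also have "\<dots> = (\<integral>x. p ^ m * (w x * \<Phi> x) \<partial>M)"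
      by (intro Bochner_Integration.integral_cong refl) simp
    also have "\<dots> = p ^ m * clique_density V w"
      using clique_density_insert(1)[OF V(4,2) w(1)] by (simp add: V(1) \<Phi>_def)
    finally have "c ^ N * W * W ^ ((Suc n + 2) * Suc n) \<le> p ^ m * clique_density V w * W ^ ((Suc n + 2) * Suc n)"
      using W by (intro mult_right_mono) auto
    also have "c ^ N * W * W ^ ((Suc n + 2) * Suc n) = c ^ N * W ^ N"
      unfolding N(1) by (simp only: power_Suc mult_ac)
    also have "\<dots> = p ^ N"
      using W by (simp add: c_def flip: power_mult_distrib)
    also have "\<dots> = p ^ m * p ^ (m + (n + 2))"
      by (simp only: N(2) power_add)
    finally show ?thesis
      using p unfolding choose p_def[symmetric] W_def[symmetric] by (simp only: mult.assoc) simp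
  qed
qed

end

section \<open>Null sets and completions\<close>

text \<open>
  The projection of the product to two distinct coordinates is measure preserving. Only the vanishing
  of the measure of preimages of null sets is proved: integrate the indicator over the coordinate
  \<open>i\<close> first and use that a single coordinate has distribution \<open>M\<close>.
\<close>
lemma AE_PiM_pair:
  fixes M :: "'a measure"
  assumes "prob_space M" and V: "finite V" "i \<in> V" "j \<in> V" "i \<noteq> j"
    and P: "AE z in M \<Otimes>\<^sub>M M. P z"
  shows "AE x in Pi\<^sub>M V (\<lambda>_. M). P (x i, x j)"
proof -
  interpret prob_space M by fact
  interpret product_sigma_finite "\<lambda>_::'b. M" ..
  interpret pair_prob_space M M ..
  let ?V = "Pi\<^sub>M V (\<lambda>_. M)" and ?U = "Pi\<^sub>M (V - {i}) (\<lambda>_. M)"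
  obtain N where N: "N \<in> null_sets (M \<Otimes>\<^sub>M M)" "{z \<in> space (M \<Otimes>\<^sub>M M). \<not> P z} \<subseteq> N"
    using P by (auto elim!: AE_E)
  then have [measurable]: "N \<in> sets (M \<Otimes>\<^sub>M M)" by auto
  have mij: "(\<lambda>x. (x i, x j)) \<in> measurable ?V (M \<Otimes>\<^sub>M M)"
    using V by (intro measurable_Pair measurable_component_singleton)
  have mind: "(\<lambda>x. indicator N (x i, x j) :: ennreal) \<in> borel_measurable ?V"
    by (rule measurable_compose[OF mij]) measurable
  have inner: "(\<lambda>z. \<integral>\<^sup>+y. indicator N (y, z) \<partial>M :: ennreal) \<in> borel_measurable M"
    by measurable
  have ins: "insert i (V - {i}) = V" using V by auto
  have "(\<integral>\<^sup>+x. indicator N (x i, x j) \<partial>?V) = (\<integral>\<^sup>+x. \<integral>\<^sup>+y. indicator N (y, x j) \<partial>M \<partial>?U)"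
    using product_nn_integral_insert[of "V - {i}" i "\<lambda>x. indicator N (x i, x j)"] V mind
    unfolding ins by simp
  also have "\<dots> = (\<integral>\<^sup>+z. \<integral>\<^sup>+y. indicator N (y, z) \<partial>M \<partial>distr ?U M (\<lambda>x. x j))"
    using V by (subst nn_integral_distr) (auto intro: inner)
  also have "distr ?U M (\<lambda>x. x j) = M"
    using V by (intro distr_PiM_component \<open>prob_space M\<close>) auto
  also have "(\<integral>\<^sup>+z. \<integral>\<^sup>+y. indicator N (y, z) \<partial>M \<partial>M) = (\<integral>\<^sup>+z. indicator N z \<partial>(M \<Otimes>\<^sub>M M))"
    by (subst nn_integral_snd[symmetric]) auto
  also have "\<dots> = 0" using N by (simp add: null_setsD1)
  finally have "AE x in ?V. indicator N (x i, x j) = (0::ennreal)"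
    using mind by (subst (asm) nn_integral_0_iff_AE)
  then show ?thesis
    using AE_space
  proof eventually_elim
    case (elim x)
    then show ?case using N(2) measurable_space[OF mij, of x] by (auto simp: indicator_eq_0_iff)
  qed
qed

lemma (in complete_measure) measurable_AE_cong:
  assumes g: "g \<in> measurable M N" and ae: "AE x in M. f x = g x"
    and f: "\<And>x. x \<in> space M \<Longrightarrow> f x \<in> space N"
  shows "f \<in> measurable M N"
proof (rule measurableI)
  fix A assume A: "A \<in> sets N"
  show "f -` A \<inter> space M \<in> sets M"
  proof (rule in_sets_AE)
    show "AE x in M. x \<in> g -` A \<inter> space M \<longleftrightarrow> x \<in> f -` A \<inter> space M"
      using ae by eventually_elim auto
  qed (use g A in \<open>auto intro: measurable_sets\<close>)
qed (rule f)

lemma complete_unit_leb: "complete_measure \<mu>"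
proof
  fix A B :: "real set"
  assume "B \<subseteq> A" "A \<in> null_sets \<mu>"
  then have "A \<in> null_sets lebesgue" "A \<subseteq> {0..1}"
    using null_sets_restrict_space[of "{0..1::real}" lebesgue A] by auto
  then show "B \<in> sets \<mu>"
    using \<open>B \<subseteq> A\<close> completion.complete[of B A lborel] by (auto simp: sets_restrict_space_iff)
qed

lemma prob_space_unit_leb: "prob_space \<mu>"
  by (rule prob_spaceI) (simp add: emeasure_restrict_space)

text \<open>
  A function measurable for the completion agrees almost everywhere with a measurable one, which is
  then truncated at the bound \<open>C\<close> of the original function.
\<close>
lemma bdd_meas_representative:
  assumes h: "case_prod h \<in> borel_measurable (completion (M \<Otimes>\<^sub>M N))"
    and C: "\<And>x y. x \<in> space M \<Longrightarrow> y \<in> space N \<Longrightarrow> \<bar>h x y\<bar> \<le> C"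
  obtains H where "case_prod H \<in> bdd_meas (M \<Otimes>\<^sub>M N)" "AE (x, y) in M \<Otimes>\<^sub>M N. h x y = H x y"
proof -
  obtain f where f: "f \<in> borel_measurable (M \<Otimes>\<^sub>M N)" "AE z in M \<Otimes>\<^sub>M N. case_prod h z = f z"
    using completion_ex_borel_measurable_real[OF h] by blast
  define H where "H x y = max (- \<bar>C\<bar>) (min \<bar>C\<bar> (f (x, y)))" for x y
  have "case_prod H = (\<lambda>z. max (- \<bar>C\<bar>) (min \<bar>C\<bar> (f z)))"
    by (auto simp: H_def)
  then have "case_prod H \<in> bdd_meas (M \<Otimes>\<^sub>M N)"
    using f(1) by (intro bdd_measI[where B="\<bar>C\<bar>"]) (auto simp: abs_le_iff)
  moreover have "AE (x, y) in M \<Otimes>\<^sub>M N. h x y = H x y"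
    using f(2) AE_space
  proof eventually_elim
    case (elim z)
    obtain x y where z: "z = (x, y)" by (cases z)
    have "\<bar>h x y\<bar> \<le> C" using elim(2) by (intro C) (auto simp: z space_pair_measure)
    then show ?case using elim by (auto simp: z H_def)
  qed
  ultimately show ?thesis by (rule that)
qed

text \<open>
  For almost every \<open>x\<close> the sections \<open>h x\<close> and \<open>H x\<close> agree almost everywhere; take \<open>x\<close> and \<open>y\<close> both
  outside the exceptional set. A section of \<open>h\<close> is only known to agree almost everywhere with a
  measurable function, and completeness of \<open>M\<close> makes the integrand with \<open>h\<close> measurable for such \<open>x\<close> and \<open>y\<close>.
\<close>
lemma AE_kernel_square_cong:
  fixes h H :: "'a \<Rightarrow> 'a \<Rightarrow> real"
  assumes "prob_space M" "complete_measure M"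
    and H: "case_prod H \<in> bdd_meas (M \<Otimes>\<^sub>M M)" and ae: "AE (x, y) in M \<Otimes>\<^sub>M M. h x y = H x y"
  shows "AE (x, y) in M \<Otimes>\<^sub>M M. (\<integral>z. h x z * h y z \<partial>M) = (\<integral>z. H x z * H y z \<partial>M)"
proof -
  interpret prob_space M by fact
  interpret complete_measure M by fact
  interpret pair_prob_space M M ..
  have good: "AE x in M. x \<in> space M \<and> (AE z in M. h x z = H x z)"
    using AE_pair[OF ae] AE_space by eventually_elim auto
  have first: "AE p in M \<Otimes>\<^sub>M M. fst p \<in> space M \<and> (AE z in M. h (fst p) z = H (fst p) z)"
  proof (rule AE_distrD[OF measurable_fst])
    have "distr (M \<Otimes>\<^sub>M M) M fst = M" by (rule prob_space.distr_pair_fst[OF \<open>prob_space M\<close>])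
    then show "AE x in distr (M \<Otimes>\<^sub>M M) M fst. x \<in> space M \<and> (AE z in M. h x z = H x z)"
      using good by (simp only:)
  qed
  have "AE p in M \<Otimes>\<^sub>M M. snd p \<in> space M \<and> (AE z in M. h (snd p) z = H (snd p) z)"
  proof -
    have "distr (M \<Otimes>\<^sub>M M) (M \<Otimes>\<^sub>M M) (\<lambda>(x, y). (y, x)) = M \<Otimes>\<^sub>M M"
      by (rule distr_pair_swap[symmetric])
    then have "AE p in distr (M \<Otimes>\<^sub>M M) (M \<Otimes>\<^sub>M M) (\<lambda>(x, y). (y, x)).
        fst p \<in> space M \<and> (AE z in M. h (fst p) z = H (fst p) z)"
      using first by (simp only:)
    from AE_distrD[OF measurable_pair_swap' this] show ?thesis
      by (simp add: case_prod_unfold)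
  qed
  with first show ?thesis
  proof eventually_elim
    case (elim p)
    obtain x y where p: "p = (x, y)" by (cases p)
    have x: "x \<in> space M" "AE z in M. h x z = H x z" and y: "y \<in> space M" "AE z in M. h y z = H y z"
      using elim by (auto simp: p)
    have HH: "(\<lambda>z. H x z * H y z) \<in> borel_measurable M"
      by (intro bdd_meas_measurable bdd_meas_mult bdd_meas_pair_section[OF H] x y)
    have ae: "AE z in M. h x z * h y z = H x z * H y z"
      using x(2) y(2) by eventually_elim auto
    have "(\<integral>z. h x z * h y z \<partial>M) = (\<integral>z. H x z * H y z \<partial>M)"
      by (rule integral_cong_AE[OF measurable_AE_cong[OF HH ae] HH ae]) simp
    then show ?case by (simp add: p)
  qed
qed

section \<open>Doubly nonnegative functions\<close>

text \<open>
  The kernel \<open>q(x,y) = \<integral> H(x,z) H(y,z) dz\<close> is positive semidefinite, since its form at \<open>a\<close> is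
  \<open>\<integral> (\<integral> H(y,z) a(y) dy)\<^sup>2 dz\<close>. The positive part makes the kernel nonnegative everywhere; as it
  changes \<open>q\<close> only on a null set, the form stays the same.
\<close>
lemma psd_kernel_truncated_square:
  fixes H :: "'a \<Rightarrow> 'a \<Rightarrow> real"
  assumes "prob_space M" and H: "case_prod H \<in> bdd_meas (M \<Otimes>\<^sub>M M)"
    and nonneg: "AE (x, y) in M \<Otimes>\<^sub>M M. 0 \<le> (\<integral>z. H x z * H y z \<partial>M)"
  shows "psd_kernel M (\<lambda>x y. max 0 (\<integral>z. H x z * H y z \<partial>M))"
proof -
  interpret prob_space M by fact
  interpret pair_prob_space M M ..
  define q where "q x y = (\<integral>z. H x z * H y z \<partial>M)" for x y
  have HH: "(\<lambda>z. H (f z) (g z)) \<in> bdd_meas N" if "f \<in> measurable N M" "g \<in> measurable N M" for f g N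
    using bdd_meas_compose[OF H measurable_Pair[OF that]] by simp
  have "case_prod (\<lambda>p z. H (fst p) z * H (snd p) z) \<in> bdd_meas ((M \<Otimes>\<^sub>M M) \<Otimes>\<^sub>M M)"
    unfolding case_prod_unfold by (intro bdd_meas_mult HH) measurable
  then have q: "case_prod q \<in> bdd_meas (M \<Otimes>\<^sub>M M)"
    unfolding q_def case_prod_unfold by (intro bdd_meas_integral \<open>prob_space M\<close>) (simp add: case_prod_unfold)
  have qk: "AE x in M. AE y in M. q x y = max 0 (q x y)"
    using AE_pair[OF nonneg] by eventually_elim (auto simp: q_def elim: eventually_mono)
  have "psd_kernel M (\<lambda>x y. max 0 (q x y))"
  proof
    obtain B where B: "\<And>z. z \<in> space (M \<Otimes>\<^sub>M M) \<Longrightarrow> \<bar>case_prod q z\<bar> \<le> B" using q by (metis bdd_measE)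
    have "(\<lambda>z. max 0 (case_prod q z)) \<in> bdd_meas (M \<Otimes>\<^sub>M M)"
      using q B
      by (intro bdd_measI[where B=B] borel_measurable_max borel_measurable_const)
        (use B in \<open>force dest: bdd_meas_measurable simp: abs_le_iff max_def\<close>)+
    then show k: "(\<lambda>(x, y). max 0 (q x y)) \<in> bdd_meas (M \<Otimes>\<^sub>M M)"
      by (simp add: case_prod_unfold)
    fix a assume a: "a \<in> bdd_meas M"
    define A where "A z = (\<integral>y. H y z * a y \<partial>M)" for z
    have A: "A \<in> bdd_meas M"
      unfolding A_def
      by (intro bdd_meas_integral \<open>prob_space M\<close>)
        (unfold case_prod_unfold, intro HH bdd_meas_mult bdd_meas_compose[OF a] measurable_fst measurable_snd)
    have qa: "(\<integral>y. q x y * a y \<partial>M) = (\<integral>z. H x z * A z \<partial>M)" if x: "x \<in> space M" for x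
    proof -
      have "(\<integral>y. q x y * a y \<partial>M) = (\<integral>y. \<integral>z. H x z * (H y z * a y) \<partial>M \<partial>M)"
        by (simp add: q_def mult.assoc[symmetric] del: integral_mult_left_zero flip: integral_mult_left_zero)
      also have "\<dots> = (\<integral>z. \<integral>y. H x z * (H y z * a y) \<partial>M \<partial>M)"
        using x by (intro bdd_meas_Fubini \<open>prob_space M\<close>)
          (unfold case_prod_unfold, intro HH bdd_meas_mult bdd_meas_compose[OF a] measurable_fst measurable_snd
            measurable_const)
      finally show ?thesis by (simp add: A_def)
    qed
    have "0 \<le> (\<integral>z. A z * A z \<partial>M)" by simp
    also have "\<dots> = (\<integral>z. \<integral>x. a x * (H x z * A z) \<partial>M \<partial>M)"
    proof (intro Bochner_Integration.integral_cong refl)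
      fix z
      have "(\<integral>x. a x * (H x z * A z) \<partial>M) = (\<integral>x. (H x z * a x) * A z \<partial>M)"
        by (intro Bochner_Integration.integral_cong refl) simp
      then show "A z * A z = (\<integral>x. a x * (H x z * A z) \<partial>M)" by (simp add: A_def)
    qed
    also have "\<dots> = (\<integral>x. \<integral>z. a x * (H x z * A z) \<partial>M \<partial>M)"
      by (intro bdd_meas_Fubini[symmetric] \<open>prob_space M\<close>)
        (unfold case_prod_unfold, intro HH bdd_meas_mult bdd_meas_compose[OF a] bdd_meas_compose[OF A]
          measurable_fst measurable_snd)
    also have "\<dots> = (\<integral>x. a x * (\<integral>y. q x y * a y \<partial>M) \<partial>M)"
      by (intro Bochner_Integration.integral_cong refl) (simp add: qa)
    also have "\<dots> = (\<integral>x. a x * (\<integral>y. max 0 (q x y) * a y \<partial>M) \<partial>M)"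
    proof (rule integral_cong_AE)
      show "AE x in M. a x * (\<integral>y. q x y * a y \<partial>M) = a x * (\<integral>y. max 0 (q x y) * a y \<partial>M)"
        using qk AE_space
      proof eventually_elim
        case (elim x)
        have "(\<integral>y. q x y * a y \<partial>M) = (\<integral>y. max 0 (q x y) * a y \<partial>M)"
          using elim(1) bdd_meas_pair_section[OF q elim(2)] bdd_meas_pair_section[OF k elim(2)] a
          by (intro integral_cong_AE) (auto dest: bdd_meas_measurable elim: eventually_mono)
        then show ?case by simp
      qed
      have "(\<lambda>x. \<integral>y. f x y * a y \<partial>M) \<in> bdd_meas M" if "case_prod f \<in> bdd_meas (M \<Otimes>\<^sub>M M)" for f
        using that by (intro bdd_meas_integral \<open>prob_space M\<close>)
          (unfold case_prod_unfold, intro bdd_meas_mult bdd_meas_compose[OF a] measurable_snd)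
      from this[OF q] this[OF k]
      show "(\<lambda>x. a x * (\<integral>y. q x y * a y \<partial>M)) \<in> borel_measurable M"
        "(\<lambda>x. a x * (\<integral>y. max 0 (q x y) * a y \<partial>M)) \<in> borel_measurable M"
        by (auto intro!: bdd_meas_measurable bdd_meas_mult a)
    qed
    finally show "0 \<le> (\<integral>x. a x * (\<integral>y. max 0 (q x y) * a y \<partial>M) \<partial>M)" .
  qed (auto simp: q_def mult.commute)
  then show ?thesis by (simp only: q_def)
qed

lemma doubly_nonnegative_kernel:
  assumes "doubly_nonnegative g"
  obtains k where "psd_kernel \<mu> k" "AE (x, y) in \<mu> \<Otimes>\<^sub>M \<mu>. g x y = k x y"
proof -
  obtain h where h: "h \<in> bounded_measurable"
    and gh: "AE (x, y) in \<mu>\<^sub>2. g x y = (\<integral>z. h x z * h y z \<partial>\<mu>)"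
    and g0: "\<And>x y. x \<in> {0..1} \<Longrightarrow> y \<in> {0..1} \<Longrightarrow> 0 \<le> g x y"
    using assms by (auto simp: doubly_nonnegative_def)
  then obtain C where C: "\<And>x y. x \<in> {0..1} \<Longrightarrow> y \<in> {0..1} \<Longrightarrow> \<bar>h x y\<bar> \<le> C"
    unfolding bounded_measurable_def by blast
  obtain H where H: "case_prod H \<in> bdd_meas (\<mu> \<Otimes>\<^sub>M \<mu>)" "AE (x, y) in \<mu> \<Otimes>\<^sub>M \<mu>. h x y = H x y"
    by (rule bdd_meas_representative[of h \<mu> \<mu> C]) (use h C in \<open>auto simp: bounded_measurable_def\<close>)
  have gH: "AE (x, y) in \<mu> \<Otimes>\<^sub>M \<mu>. g x y = (\<integral>z. H x z * H y z \<partial>\<mu>) \<and> 0 \<le> g x y"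
    using gh[unfolded AE_completion_iff] AE_space
      AE_kernel_square_cong[OF prob_space_unit_leb complete_unit_leb H]
    by eventually_elim (auto simp: space_pair_measure intro: g0)
  show ?thesis
  proof (rule that)
    show "psd_kernel \<mu> (\<lambda>x y. max 0 (\<integral>z. H x z * H y z \<partial>\<mu>))"
      by (intro psd_kernel_truncated_square prob_space_unit_leb H eventually_mono[OF gH]) auto
    show "AE (x, y) in \<mu> \<Otimes>\<^sub>M \<mu>. g x y = max 0 (\<integral>z. H x z * H y z \<partial>\<mu>)"
      using gH by eventually_elim auto
  qed
qed

text \<open>
  There are finitely many edges, and each factor is changed only on a null set of the cube.
\<close>
lemma (in psd_kernel) integral_edge_product_completion:
  fixes V :: "'v::linorder set"
  assumes V: "finite V" and ae: "AE (x, y) in M \<Otimes>\<^sub>M M. g x y = k x y"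
  shows "(\<integral>x. (\<Prod>e\<in>nsets V 2. g (x (Min e)) (x (Max e))) \<partial>completion (Pi\<^sub>M V (\<lambda>_. M)))
    = clique_density V (\<lambda>_. 1)"
proof -
  let ?V = "Pi\<^sub>M V (\<lambda>_. M)"
  let ?f = "\<lambda>x. \<Prod>e\<in>nsets V 2. k (x (Min e)) (x (Max e))"
  let ?g = "\<lambda>x. \<Prod>e\<in>nsets V 2. g (x (Min e)) (x (Max e))"
  have "AE x in ?V. \<forall>e\<in>nsets V 2. g (x (Min e)) (x (Max e)) = k (x (Min e)) (x (Max e))"
  proof (rule AE_finite_allI)
    fix e assume e: "e \<in> nsets V 2"
    have "Min e \<noteq> Max e" using e by (auto simp: nsets_2_eq min_def max_def split: if_splits)
    then show "AE x in ?V. g (x (Min e)) (x (Max e)) = k (x (Min e)) (x (Max e))"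
      using AE_PiM_pair[OF prob_space_axioms V Min_Max_edge[OF e] _ ae] by simp
  qed (rule finite_imp_finite_nsets[OF V])
  then have eq: "AE x in completion ?V. ?g x = ?f x"
    by (intro AE_completion) (auto elim!: eventually_mono intro!: prod.cong)
  have f: "?f \<in> borel_measurable ?V"
    using clique_integrand_bdd_meas[OF bdd_meas_const V, of 1] by (auto dest: bdd_meas_measurable)
  have f': "?f \<in> borel_measurable (completion ?V)" by (rule measurable_completion[OF f])
  have "(\<integral>x. ?g x \<partial>completion ?V) = (\<integral>x. ?f x \<partial>completion ?V)"
    by (rule integral_cong_AE[OF completion.measurable_AE_cong[OF f' eq] f' eq]) simp
  also have "\<dots> = clique_density V (\<lambda>_. 1)" by (simp add: integral_completion[OF f] clique_density_def)
  finally show ?thesis .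
qed

lemma (in psd_kernel) integral_kernel:
  assumes ae: "AE (x, y) in M \<Otimes>\<^sub>M M. g x y = k x y"
  shows "(\<integral>(x, y). g x y \<partial>completion (M \<Otimes>\<^sub>M M)) = form (\<lambda>_. 1) (\<lambda>_. 1)"
proof -
  interpret pair_prob_space M M ..
  have k: "case_prod k \<in> borel_measurable (M \<Otimes>\<^sub>M M)" by (rule bdd_meas_measurable[OF k_bdd_meas])
  have k': "case_prod k \<in> borel_measurable (completion (M \<Otimes>\<^sub>M M))" by (rule measurable_completion[OF k])
  have eq: "AE z in completion (M \<Otimes>\<^sub>M M). case_prod g z = case_prod k z"
    using ae by (intro AE_completion) (simp add: case_prod_unfold)
  have "(\<integral>z. case_prod g z \<partial>completion (M \<Otimes>\<^sub>M M)) = (\<integral>z. case_prod k z \<partial>completion (M \<Otimes>\<^sub>M M))"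
    by (rule integral_cong_AE[OF completion.measurable_AE_cong[OF k' eq] k' eq]) simp
  also have "\<dots> = (\<integral>x. \<integral>y. k x y \<partial>M \<partial>M)"
    by (simp add: integral_completion[OF k] integral_fst[OF P.bdd_meas_integrable[OF k_bdd_meas]])
  finally show ?thesis by (simp add: form_def weighted_degree_def)
qed

lemma complete_graph_density:
  fixes V :: "'v::linorder set"
  assumes "doubly_nonnegative g" "finite V"
  shows "(\<integral>(x, y). g x y \<partial>\<mu>\<^sub>2) ^ (card V choose 2) \<le> hom_density V (nsets V 2) g"
proof -
  obtain k where k: "psd_kernel \<mu> k" and ae: "AE (x, y) in \<mu> \<Otimes>\<^sub>M \<mu>. g x y = k x y"
    using doubly_nonnegative_kernel[OF assms(1)] .
  interpret psd_kernel \<mu> k by fact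
  have hom: "hom_density V (nsets V 2) g = clique_density V (\<lambda>_. 1)"
    unfolding hom_density_def by (rule integral_edge_product_completion[OF assms(2) ae])
  have "form (\<lambda>_. 1) (\<lambda>_. 1) ^ (card V choose 2) \<le> clique_density V (\<lambda>_. 1)"
  proof (cases "card V < 2")
    case True
    then have "V = {} \<or> (\<exists>v. V = {v})"
      using assms(2) by (auto simp: less_2_cases_iff card_1_singleton_iff)
    then have "clique_density V (\<lambda>_. 1) = 1"
      using clique_density_insert(1)[of "{}" _ "\<lambda>_. 1"] prob_space by (auto simp: bdd_meas_const clique_density_empty)
    then show ?thesis using True by (simp add: binomial_eq_0)
  next
    case False
    then have "card V = (card V - 2) + 2" by simp
    from clique_density_power_bound[OF bdd_meas_const _ this, of 1] this
    show ?thesis using prob_space by simp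
  qed
  then show ?thesis unfolding hom integral_kernel[OF ae] .
qed

theorem corollary5p2:
  fixes n :: nat
  assumes "n \<ge> 1"
  shows "good_graph (complete_verts n) (complete_edges n) \<and>
    (\<forall>g. doubly_nonnegative g \<longrightarrow>
       hom_density (complete_verts n) (complete_edges n) g
         \<ge> (\<integral>(x, y). g x y \<partial>\<mu>\<^sub>2) ^ (n * (n - 1) div 2))"
proof -
  have V: "finite (complete_verts n)" "card (complete_verts n) = n"
    by (auto simp: complete_verts_def)
  have "card (complete_edges n) = n * (n - 1) div 2"
    by (simp add: complete_edges_def V choose_two)
  moreover have "(\<integral>(x, y). g x y \<partial>\<mu>\<^sub>2) ^ (n * (n - 1) div 2)
      \<le> hom_density (complete_verts n) (complete_edges n) g" if "doubly_nonnegative g" for g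
    using complete_graph_density[OF that V(1)] by (simp add: V choose_two complete_edges_def)
  ultimately show ?thesis
    using V by (auto simp: good_graph_def finite_simple_graph_def complete_edges_def)
qed

end
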